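(* Let $K\ge3$, $S_p=[1:K-2]$. The capacity region of the $K$-receiver combination network with two messages $M_{\overline{K}}$ (required by receivers $[1:K-1]$) and $M_{\overline{K-1}}$ (required by receivers $[1:K]\setminus\{K-1\}$) is the set of rate pairs $(R_{\overline{K}},R_{\overline{K-1}})$ with $R_{\overline{K-1}}\le C_{\mathsf{W}_K^{\mathsf{P}}}$, $R_{\overline{K}}\le C_{\mathsf{W}_{K-1}^{\mathsf{P}}}$, $R_{\overline{K-1}}+R_{\overline{K}}\le C_{\mathsf{W}_j^{\mathsf{P}}}$ for all $j\in S_p$, $R_{\overline{K-1}}+R_{\overline{K}}\le C_{\downarrow_{\mathsf{W}_{K-1}^{\mathsf{P}}}\{\overline{\{K\}}\}}+C_{\mathsf{W}_K^{\mathsf{P}}}$, $2R_{\overline{K-1}}+2R_{\overline{K}}\le C_{\downarrow_{\mathsf{W}_j^{\mathsf{P}}}\{\overline{\{K-1\}},\overline{\{K\}}\}}+C_{\mathsf{W}_K^{\mathsf{P}}}+C_{\mathsf{W}_{K-1}^{\mathsf{P}}}$ for all $j\in S_p$.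
   Context: The $K$-receiver combination network with capacities $C_S\ge0$, $S\in\mathsf{P}$ ($\mathsf{P}$ = nonempty subsets of $[1:K]$): the deterministic broadcast channel with input $X=(V_S:S\in\mathsf{P})$, $V_S$ in a finite set $\mathcal{V}_S$ with $|\mathcal{V}_S|=2^{C_S}$, and outputs $Y_i=(V_S:S\in\mathsf{W}_i^{\mathsf{P}})$, where $\mathsf{W}_i^{\mathsf{P}}=\{T\in\mathsf{P}:i\in T\}$. Messages are independent, each required by the indicated receivers; achievability (vanishing probability that some receiver mis-decodes a required message) and capacity region as usual. $C_{\mathsf{W}}=\sum_{S\in\mathsf{W}}C_S$; $\overline{A}=[1:K]\setminus A$; $\downarrow_{\mathsf{Q}_2}\mathsf{Q}_1=\{T\in\mathsf{Q}_2:T\subseteq T'\text{ for some }T'\in\mathsf{Q}_1\}$. *)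

theory Defs
  imports "HOL-Analysis.Analysis"
begin

definition PP :: "nat \<Rightarrow> nat set set" where
  "PP K = {S. S \<subseteq> {1..K} \<and> S \<noteq> {}}"

text \<open>W_i^P: the links seen by receiver i.\<close>
definition WW :: "nat \<Rightarrow> nat \<Rightarrow> nat set set" where
  "WW K i = {T \<in> PP K. i \<in> T}"

definition cmpl :: "nat \<Rightarrow> nat set \<Rightarrow> nat set" where
  "cmpl K A = {1..K} - A"

definition down :: "nat set set \<Rightarrow> nat set set \<Rightarrow> nat set set" where
  "down Q2 Q1 = {T \<in> Q2. \<exists>T'\<in>Q1. T \<subseteq> T'}"

text \<open>Link capacities: C_S = log2 |V_S| where N S = |V_S|.\<close>
definition cap :: "(nat set \<Rightarrow> nat) \<Rightarrow> nat set \<Rightarrow> real" where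
  "cap N S = log 2 (real (N S))"

definition Csum :: "(nat set \<Rightarrow> nat) \<Rightarrow> nat set set \<Rightarrow> real" where
  "Csum N W = (\<Sum>S\<in>W. cap N S)"

definition msgsize :: "nat \<Rightarrow> real \<Rightarrow> nat" where
  "msgsize n r = nat \<lceil>2 powr (real n * r)\<rceil>"

text \<open>Messages are indexed by their demand sets A (message M_A is required by every
  receiver in A). A message tuple assigns to each A in Ms a value below msgsize n (R A).\<close>
definition msgset :: "nat set set \<Rightarrow> (nat set \<Rightarrow> real) \<Rightarrow> nat \<Rightarrow> (nat set \<Rightarrow> nat) set" where
  "msgset Ms R n = PiE Ms (\<lambda>A. {..<msgsize n (R A)})"

text \<open>Encoder enc m S t: symbol sent on link S at time t (in V_S = {..<N S}).\<close>
definition valid_encoder :: "nat \<Rightarrow> (nat set \<Rightarrow> nat) \<Rightarrow> nat set set \<Rightarrow> (nat set \<Rightarrow> real) \<Rightarrow> nat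
      \<Rightarrow> ((nat set \<Rightarrow> nat) \<Rightarrow> nat set \<Rightarrow> nat \<Rightarrow> nat) \<Rightarrow> bool" where
  "valid_encoder K N Ms R n enc \<longleftrightarrow>
     (\<forall>m\<in>msgset Ms R n. \<forall>S\<in>PP K. \<forall>t<n. enc m S t < N S)"

definition obs :: "nat \<Rightarrow> nat \<Rightarrow> ((nat set \<Rightarrow> nat) \<Rightarrow> nat set \<Rightarrow> nat \<Rightarrow> nat) \<Rightarrow> nat
      \<Rightarrow> (nat set \<Rightarrow> nat) \<Rightarrow> nat set \<Rightarrow> nat \<Rightarrow> nat" where
  "obs K n enc i m = (\<lambda>S t. if S \<in> WW K i \<and> t < n then enc m S t else 0)"

definition err_event :: "nat \<Rightarrow> nat set set \<Rightarrow> nat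
      \<Rightarrow> ((nat set \<Rightarrow> nat) \<Rightarrow> nat set \<Rightarrow> nat \<Rightarrow> nat)
      \<Rightarrow> (nat \<Rightarrow> (nat set \<Rightarrow> nat \<Rightarrow> nat) \<Rightarrow> nat set \<Rightarrow> nat)
      \<Rightarrow> (nat set \<Rightarrow> nat) \<Rightarrow> bool" where
  "err_event K Ms n enc dec m \<longleftrightarrow>
     (\<exists>A\<in>Ms. \<exists>i\<in>A. dec i (obs K n enc i m) A \<noteq> m A)"

text \<open>Probability of error under independent uniformly distributed messages.\<close>
definition perr :: "nat \<Rightarrow> nat set set \<Rightarrow> (nat set \<Rightarrow> real) \<Rightarrow> nat
      \<Rightarrow> ((nat set \<Rightarrow> nat) \<Rightarrow> nat set \<Rightarrow> nat \<Rightarrow> nat)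
      \<Rightarrow> (nat \<Rightarrow> (nat set \<Rightarrow> nat \<Rightarrow> nat) \<Rightarrow> nat set \<Rightarrow> nat) \<Rightarrow> real" where
  "perr K Ms R n enc dec =
     real (card {m \<in> msgset Ms R n. err_event K Ms n enc dec m}) / real (card (msgset Ms R n))"

definition achievable :: "nat \<Rightarrow> (nat set \<Rightarrow> nat) \<Rightarrow> nat set set \<Rightarrow> (nat set \<Rightarrow> real) \<Rightarrow> bool" where
  "achievable K N Ms R \<longleftrightarrow> (\<forall>A\<in>Ms. 0 \<le> R A) \<and>
     (\<exists>enc dec. (\<forall>n. valid_encoder K N Ms R n (enc n)) \<and>
        (\<lambda>n. perr K Ms R n (enc n) (dec n)) \<longlonglongrightarrow> 0)"

text \<open>Capacity region for two messages M_A1, M_A2 (A1 \<noteq> A2): closure of achievable pairs.\<close>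
definition capacity_region2 :: "nat \<Rightarrow> (nat set \<Rightarrow> nat) \<Rightarrow> nat set \<Rightarrow> nat set \<Rightarrow> (real \<times> real) set" where
  "capacity_region2 K N A1 A2 =
     closure {(r1, r2). achievable K N {A1, A2} (\<lambda>A. if A = A1 then r1 else r2)}"

end

theory Submission
  imports Defs
begin

text \<open>
  Write \<open>a = K - 1\<close> and \<open>b = K\<close>, and let \<open>M\<^sub>1\<close> be required by all receivers but \<open>b\<close>, and \<open>M\<^sub>2\<close> by all but \<open>a\<close>.

  Converse, by counting on the set \<open>G\<close> of correctly decoded message pairs, which is at least half of
  all pairs. Let \<open>v\<close> be what is sent on the links seen by both \<open>a\<close> and \<open>b\<close>. The output of \<open>a\<close>
  determines \<open>(M\<^sub>1, v)\<close>, that of \<open>b\<close> determines \<open>(M\<^sub>2, v)\<close>, and a fibre of \<open>v\<close> in \<open>G\<close> is at most as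
  large as the number of signals on the remaining links of \<open>j\<close>. Each fibre is also contained in the
  product of its projections, so Cauchy-Schwarz over the values of \<open>v\<close> bounds \<open>|G|\<^sup>2\<close> by the product of
  the three counts. This replaces the entropy inequality \<open>H(v | M\<^sub>1) + H(v | M\<^sub>2) \<ge> H(v)\<close>.

  Achievability, by random coding after splitting \<open>M\<^sub>i = (P\<^sub>i, Q\<^sub>i)\<close> with rates
  \<open>p\<^sub>1 = min r\<^sub>1 (C\<^sub>b - r\<^sub>2)\<close> and \<open>p\<^sub>2 = min r\<^sub>2 (C\<^sub>a - r\<^sub>1)\<close>: receiver \<open>a\<close> decodes \<open>M\<^sub>1\<close> and \<open>P\<^sub>2\<close>, receiver \<open>b\<close>
  decodes \<open>M\<^sub>2\<close> and \<open>P\<^sub>1\<close>, all others decode everything. The union bound over the set \<open>F\<close> of parts in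
  which a wrong candidate differs from the true one asks that the rate of \<open>F\<close> is below the capacity
  of the links of the receiver that depend on some part in \<open>F\<close>; these conditions follow from the
  inequalities of the region.
\<close>

section \<open>Random coding and the union bound\<close>

text \<open>In a colliding table \<open>c\<close> the entry at \<open>(i, y i)\<close> repeats the
  one at \<open>(i, x i)\<close>. Overwriting it by an arbitrary \<open>v i\<close> loses nothing,
  because \<open>x i \<noteq> y i\<close> keeps the copy intact; so \<open>h\<close> is injective.
  In probabilistic terms, independent uniform entries collide on all of \<open>J\<close> with
  probability at most the inverse of the product.\<close>

lemma card_collisions:
  fixes X :: "'i \<Rightarrow> 'x set" and V :: "'i \<Rightarrow> 'v set"
  assumes fin: "finite I" "\<And>i. i \<in> I \<Longrightarrow> finite (X i)" "\<And>i. i \<in> I \<Longrightarrow> finite (V i)"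
    and J: "J \<subseteq> I" and xX: "\<And>i. i \<in> J \<Longrightarrow> x i \<in> X i" and yX: "\<And>i. i \<in> J \<Longrightarrow> y i \<in> X i"
    and neq: "\<And>i. i \<in> J \<Longrightarrow> x i \<noteq> y i"
  shows "card {c \<in> PiE (Sigma I X) (\<lambda>z. V (fst z)). \<forall>i\<in>J. c (i, x i) = c (i, y i)} * (\<Prod>i\<in>J. card (V i))
    \<le> card (PiE (Sigma I X) (\<lambda>z. V (fst z)))"
proof -
  define \<Omega> where "\<Omega> = PiE (Sigma I X) (\<lambda>z. V (fst z))"
  define A where "A = {c \<in> \<Omega>. \<forall>i\<in>J. c (i, x i) = c (i, y i)}"
  define h where "h = (\<lambda>(c :: 'i \<times> 'x \<Rightarrow> 'v, v) z. if fst z \<in> J \<and> snd z = y (fst z) then v (fst z) else c z)"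
  have finO: "finite \<Omega>" unfolding \<Omega>_def
    by (intro finite_PiE finite_SigmaI) (use fin in auto)
  have "inj_on h (A \<times> PiE J V)"
  proof (rule inj_onI, clarify)
    fix c v c' v'
    assume c: "c \<in> A" and c': "c' \<in> A" and v: "v \<in> PiE J V" and v': "v' \<in> PiE J V"
      and eq: "h (c, v) = h (c', v')"
    have at: "h (c, v) z = h (c', v') z" for z using eq by simp
    have "v i = v' i" if "i \<in> J" for i using at[of "(i, y i)"] that by (simp add: h_def)
    then have "v = v'" using v v' by (intro PiE_ext[OF v v']) auto
    moreover have "c z = c' z" for z
    proof (cases "fst z \<in> J \<and> snd z = y (fst z)")
      case True
      then obtain i where z: "z = (i, y i)" and i: "i \<in> J" by (metis prod.collapse)
      have "c (i, x i) = c' (i, x i)" using at[of "(i, x i)"] neq[OF i] by (simp add: h_def)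
      then show ?thesis using c c' i by (simp add: A_def z)
    next
      case False
      then show ?thesis using at[of z] by (simp add: h_def split: if_splits)
    qed
    ultimately show "c = c' \<and> v = v'" by blast
  qed
  moreover have "h ` (A \<times> PiE J V) \<subseteq> \<Omega>"
    using J yX by (fastforce simp: h_def A_def \<Omega>_def PiE_iff extensional_def)
  ultimately have "card (A \<times> PiE J V) \<le> card \<Omega>" using finO by (rule card_inj_on_le)
  moreover have "card (PiE J V) = (\<Prod>i\<in>J. card (V i))"
    using fin(1) J finite_subset by (intro card_PiE) blast
  ultimately show ?thesis by (simp add: card_cartesian_product A_def \<Omega>_def)
qed

text \<open>First-moment argument: the average over all codebooks satisfies the bound, hence some
  codebook does. Here \<open>I\<close> indexes links and \<open>G\<close> message parts,
  \<open>E i\<close> are the parts carried by link \<open>i\<close>, and receiver \<open>r\<close>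
  sees the links \<open>W r\<close> and decodes the parts \<open>D r\<close>. A summand is the
  number of candidates that are wrong in exactly the parts \<open>F\<close> of \<open>D r\<close>,
  times their collision probability.\<close>

lemma random_code:
  fixes E :: "'i \<Rightarrow> 'g set" and V :: "'i \<Rightarrow> 'v set" and s :: "'g \<Rightarrow> nat" and u :: "'m \<Rightarrow> 'g \<Rightarrow> nat"
    and W :: "'r \<Rightarrow> 'i set" and D :: "'r \<Rightarrow> 'g set"
  assumes finI: "finite I" and finV: "\<And>i. i \<in> I \<Longrightarrow> finite (V i)" and neV: "\<And>i. i \<in> I \<Longrightarrow> V i \<noteq> {}"
    and finG: "finite G" and finM: "finite M" and finR: "finite R"
    and u: "\<And>m. m \<in> M \<Longrightarrow> u m \<in> PiE G (\<lambda>g. {..<s g})"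
    and W: "\<And>r. r \<in> R \<Longrightarrow> W r \<subseteq> I" and D: "\<And>r. r \<in> R \<Longrightarrow> D r \<subseteq> G"
    and E: "\<And>r i. r \<in> R \<Longrightarrow> i \<in> W r \<Longrightarrow> E i \<subseteq> D r" and EG: "\<And>i. i \<in> I \<Longrightarrow> E i \<subseteq> G"
  shows "\<exists>c. (\<forall>i\<in>I. \<forall>w\<in>PiE G (\<lambda>g. {..<s g}). c i (restrict w (E i)) \<in> V i) \<and>
    real (card {m \<in> M. \<exists>r\<in>R. \<exists>w\<in>PiE G (\<lambda>g. {..<s g}). (\<exists>g\<in>D r. w g \<noteq> u m g) \<and>
            (\<forall>i\<in>W r. c i (restrict (u m) (E i)) = c i (restrict w (E i)))})
      \<le> real (card M) * (\<Sum>r\<in>R. \<Sum>F\<in>Pow (D r) - {{}}.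
            (\<Prod>g\<in>F. real (s g - 1)) / (\<Prod>i\<in>{i \<in> W r. E i \<inter> F \<noteq> {}}. real (card (V i))))"
proof -
  define U where "U = PiE G (\<lambda>g. {..<s g})"
  define X where "X = (\<lambda>i. PiE (E i) (\<lambda>g. {..<s g}))"
  \<comment> \<open>A codebook is a table with one entry for each link and each value of the parts
    on that link; counting tables stands for uniform random choice.\<close>
  define \<Omega> where "\<Omega> = PiE (Sigma I X) (\<lambda>z. V (fst z))"
  define bad where "bad = (\<lambda>c :: 'i \<times> ('g \<Rightarrow> nat) \<Rightarrow> 'v. {m \<in> M. \<exists>r\<in>R. \<exists>w\<in>U. (\<exists>g\<in>D r. w g \<noteq> u m g) \<and>
     (\<forall>i\<in>W r. c (i, restrict (u m) (E i)) = c (i, restrict w (E i)))})"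
  \<comment> \<open>Candidates are grouped by the exact set \<open>F\<close> of wrong parts, so
    every coordinate in \<open>F\<close> avoids the true value. This is the source of
    \<open>s g - 1\<close>.\<close>
  define T where "T = (\<lambda>m F. PiE F (\<lambda>g. {..<s g} - {u m g}))"
  define J where "J = (\<lambda>r F. {i \<in> W r. E i \<inter> F \<noteq> {}})"
  define coll where "coll = (\<lambda>(c :: 'i \<times> ('g \<Rightarrow> nat) \<Rightarrow> 'v) m r F w. \<forall>i\<in>J r F. c (i, restrict (u m) (E i))
     = c (i, restrict (override_on (u m) w F) (E i)))"
  define P where "P = (\<lambda>r F. (\<Prod>i\<in>J r F. real (card (V i))))"
  define B where "B = (\<Sum>r\<in>R. \<Sum>F\<in>Pow (D r) - {{}}. (\<Prod>g\<in>F. real (s g - 1)) / P r F)"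
  have finE: "finite (E i)" if "i \<in> I" for i using EG[OF that] finG finite_subset by blast
  have finX: "finite (X i)" if "i \<in> I" for i
    unfolding X_def using finE[OF that] by (intro finite_PiE) auto
  have finD: "finite (D r)" if "r \<in> R" for r using D[OF that] finG finite_subset by blast
  have finT: "finite (T m F)" if "finite F" for m F
    unfolding T_def using that by (intro finite_PiE) auto
  have finO: "finite \<Omega>" unfolding \<Omega>_def
    by (intro finite_PiE finite_SigmaI) (use finI finX finV in auto)
  have neO: "\<Omega> \<noteq> {}" unfolding \<Omega>_def using neV by (auto simp: PiE_eq_empty_iff)
  have resX: "restrict w (E i) \<in> X i" if "w \<in> U" "i \<in> I" for w i
    using that EG unfolding U_def X_def by fastforce
  have count: "real (card (bad c)) \<le>
     (\<Sum>m\<in>M. \<Sum>r\<in>R. \<Sum>F\<in>Pow (D r) - {{}}. \<Sum>w\<in>T m F. of_bool (coll c m r F w))" for c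
  proof -
    have "of_bool (m \<in> bad c) \<le>
       (\<Sum>r\<in>R. \<Sum>F\<in>Pow (D r) - {{}}. \<Sum>w\<in>T m F. of_bool (coll c m r F w) :: real)" if m: "m \<in> M" for m
    proof (cases "m \<in> bad c")
      case True
      then obtain r w where r: "r \<in> R" and w: "w \<in> U" and ex: "\<exists>g\<in>D r. w g \<noteq> u m g"
        and eq: "\<forall>i\<in>W r. c (i, restrict (u m) (E i)) = c (i, restrict w (E i))"
        by (auto simp: bad_def)
      define F where "F = {g \<in> D r. w g \<noteq> u m g}"
      have F: "F \<in> Pow (D r) - {{}}" using ex by (auto simp: F_def)
      have wT: "restrict w F \<in> T m F"
        using w D[OF r] by (auto simp: T_def F_def U_def)
      \<comment> \<open>The links seen by \<open>r\<close> carry only parts in \<open>D r\<close>,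
        and \<open>F\<close> records every difference there; what \<open>w\<close> does outside
        \<open>D r\<close> is invisible to \<open>r\<close>.\<close>
      have "restrict (override_on (u m) (restrict w F) F) (E i) = restrict w (E i)" if "i \<in> W r" for i
        using E[OF r that] by (auto simp: fun_eq_iff override_on_def F_def)
      then have cl: "coll c m r F (restrict w F)" using eq by (simp add: coll_def J_def)
      have finF: "finite F" using finD[OF r] by (auto simp: F_def)
      have "1 = (of_bool (coll c m r F (restrict w F)) :: real)" using cl by simp
      also have "\<dots> \<le> (\<Sum>w\<in>T m F. of_bool (coll c m r F w))"
        by (rule member_le_sum[OF wT]) (use finT[OF finF] in auto)
      also have "\<dots> \<le> (\<Sum>F\<in>Pow (D r) - {{}}. \<Sum>w\<in>T m F. of_bool (coll c m r F w))"
        by (rule member_le_sum[OF F, of "\<lambda>F. \<Sum>w\<in>T m F. of_bool (coll c m r F w)"])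
          (use finD[OF r] in \<open>auto intro: sum_nonneg\<close>)
      also have "\<dots> \<le> (\<Sum>r\<in>R. \<Sum>F\<in>Pow (D r) - {{}}. \<Sum>w\<in>T m F. of_bool (coll c m r F w))"
        by (rule member_le_sum[OF r, of "\<lambda>r. \<Sum>F\<in>Pow (D r) - {{}}. \<Sum>w\<in>T m F. of_bool (coll c m r F w)"])
          (use finR in \<open>auto intro!: sum_nonneg\<close>)
      finally show ?thesis using True by simp
    qed (auto intro!: sum_nonneg)
    then have "(\<Sum>m\<in>M. of_bool (m \<in> bad c)) \<le>
       (\<Sum>m\<in>M. \<Sum>r\<in>R. \<Sum>F\<in>Pow (D r) - {{}}. \<Sum>w\<in>T m F. of_bool (coll c m r F w) :: real)"
      by (rule sum_mono)
    moreover have "(\<Sum>m\<in>M. of_bool (m \<in> bad c)) = real (card (bad c))"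
    proof -
      have "M \<inter> {m. m \<in> bad c} = bad c" by (auto simp: bad_def)
      then show ?thesis using finM by (simp add: sum.If_cases of_bool_def)
    qed
    ultimately show ?thesis by simp
  qed
  have prob: "(\<Sum>c\<in>\<Omega>. of_bool (coll c m r F w)) \<le> real (card \<Omega>) / P r F"
    if m: "m \<in> M" and r: "r \<in> R" and F: "F \<in> Pow (D r) - {{}}" and w: "w \<in> T m F" for m r F w
  proof -
    have JI: "J r F \<subseteq> I" using W[OF r] by (auto simp: J_def)
    have ov: "override_on (u m) w F \<in> U"
    proof -
      have FG: "F \<subseteq> G" using F D[OF r] by blast
      have "override_on (u m) w F g < s g" if "g \<in> G" for g
        using w u[OF m] that by (cases "g \<in> F") (auto simp: T_def PiE_iff)
      moreover have "override_on (u m) w F g = undefined" if "g \<notin> G" for g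
        using u[OF m] that FG by (auto simp: override_on_def PiE_iff extensional_def)
      ultimately show ?thesis by (auto simp: U_def PiE_iff extensional_def)
    qed
    have neq: "restrict (u m) (E i) \<noteq> restrict (override_on (u m) w F) (E i)" if i: "i \<in> J r F" for i
    proof -
      obtain g where g: "g \<in> E i" "g \<in> F" using i unfolding J_def by blast
      have "w g \<noteq> u m g" using w g(2) by (auto simp: T_def)
      then show ?thesis using g by (metis override_on_apply_in restrict_apply')
    qed
    have "card {c \<in> \<Omega>. coll c m r F w} * (\<Prod>i\<in>J r F. card (V i)) \<le> card \<Omega>"
      unfolding coll_def \<Omega>_def
    proof (rule card_collisions[OF finI finX finV JI])
      show "restrict (u m) (E i) \<in> X i" if "i \<in> J r F" for i
        using resX[of "u m"] u[OF m] JI that unfolding U_def by blast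
      show "restrict (override_on (u m) w F) (E i) \<in> X i" if "i \<in> J r F" for i
        using resX[OF ov] JI that by blast
    qed (assumption | erule neq)+
    then have "real (card {c \<in> \<Omega>. coll c m r F w} * (\<Prod>i\<in>J r F. card (V i))) \<le> real (card \<Omega>)"
      by (rule of_nat_mono)
    then have "real (card {c \<in> \<Omega>. coll c m r F w}) * P r F \<le> real (card \<Omega>)"
      unfolding P_def of_nat_mult of_nat_prod .
    moreover have "P r F > 0" unfolding P_def
      using JI neV finV by (intro prod_pos) (auto simp: card_gt_0_iff)
    moreover have "(\<Sum>c\<in>\<Omega>. of_bool (coll c m r F w)) = real (card {c \<in> \<Omega>. coll c m r F w})"
      using finO by (simp add: sum.If_cases of_bool_def Int_def)
    ultimately show ?thesis by (simp add: field_simps)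
  qed
  have cardT: "real (card (T m F)) = (\<Prod>g\<in>F. real (s g - 1))"
    if m: "m \<in> M" and r: "r \<in> R" and F: "F \<in> Pow (D r) - {{}}" for m r F
  proof -
    have "finite F" using F finD[OF r] finite_subset by blast
    moreover have "card ({..<s g} - {u m g}) = s g - 1" if "g \<in> F" for g
    proof -
      have "u m g < s g" using u[OF m] F D[OF r] that by (auto simp: PiE_iff)
      then show ?thesis by simp
    qed
    ultimately show ?thesis unfolding T_def by (simp add: card_PiE)
  qed
  \<comment> \<open>The sum over codebooks is moved innermost, where \<open>prob\<close> bounds each
    single collision.\<close>
  have "(\<Sum>c\<in>\<Omega>. real (card (bad c))) \<le> (\<Sum>c\<in>\<Omega>. \<Sum>m\<in>M. \<Sum>r\<in>R. \<Sum>F\<in>Pow (D r) - {{}}.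
      \<Sum>w\<in>T m F. of_bool (coll c m r F w))"
    by (intro sum_mono count)
  also have "\<dots> = (\<Sum>m\<in>M. \<Sum>c\<in>\<Omega>. \<Sum>r\<in>R. \<Sum>F\<in>Pow (D r) - {{}}.
      \<Sum>w\<in>T m F. of_bool (coll c m r F w))"
    by (rule sum.swap)
  also have "\<dots> = (\<Sum>m\<in>M. \<Sum>r\<in>R. \<Sum>c\<in>\<Omega>. \<Sum>F\<in>Pow (D r) - {{}}.
      \<Sum>w\<in>T m F. of_bool (coll c m r F w))"
    by (intro sum.cong refl, rule sum.swap)
  also have "\<dots> = (\<Sum>m\<in>M. \<Sum>r\<in>R. \<Sum>F\<in>Pow (D r) - {{}}. \<Sum>c\<in>\<Omega>.
      \<Sum>w\<in>T m F. of_bool (coll c m r F w))"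
    by (intro sum.cong refl, rule sum.swap)
  also have "\<dots> = (\<Sum>m\<in>M. \<Sum>r\<in>R. \<Sum>F\<in>Pow (D r) - {{}}. \<Sum>w\<in>T m F.
      \<Sum>c\<in>\<Omega>. of_bool (coll c m r F w))"
    by (intro sum.cong refl, rule sum.swap)
  also have "\<dots> \<le> (\<Sum>m\<in>M. \<Sum>r\<in>R. \<Sum>F\<in>Pow (D r) - {{}}. \<Sum>w\<in>T m F. real (card \<Omega>) / P r F)"
    by (intro sum_mono prob)
  also have "\<dots> = (\<Sum>m\<in>M. \<Sum>r\<in>R. \<Sum>F\<in>Pow (D r) - {{}}.
      real (card \<Omega>) * ((\<Prod>g\<in>F. real (s g - 1)) / P r F))"
    by (intro sum.cong refl) (simp add: cardT)
  also have "\<dots> = real (card \<Omega>) * (real (card M) * B)"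
    by (simp add: B_def sum_distrib_left mult_ac)
  finally have avg: "(\<Sum>c\<in>\<Omega>. real (card (bad c))) \<le> real (card \<Omega>) * (real (card M) * B)" .
  have "\<exists>c\<in>\<Omega>. real (card (bad c)) \<le> real (card M) * B"
  proof (rule ccontr)
    assume "\<not> ?thesis"
    then have "(\<Sum>c\<in>\<Omega>. real (card M) * B) < (\<Sum>c\<in>\<Omega>. real (card (bad c)))"
      using finO neO by (intro sum_strict_mono) auto
    then show False using avg by simp
  qed
  then obtain c where c: "c \<in> \<Omega>" and le: "real (card (bad c)) \<le> real (card M) * B" by blast
  show ?thesis
  proof (intro exI[of _ "\<lambda>i x. c (i, x)"] conjI ballI)
    fix i w assume "i \<in> I" "w \<in> PiE G (\<lambda>g. {..<s g})"
    then have "(i, restrict w (E i)) \<in> Sigma I X" using resX by (auto simp: U_def)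
    then show "c (i, restrict w (E i)) \<in> V i" using c unfolding \<Omega>_def by fastforce
  qed (use le in \<open>simp add: bad_def B_def P_def J_def U_def\<close>)
qed

section \<open>A counting inequality from Cauchy-Schwarz\<close>

text \<open>Each fibre of \<open>v\<close> has size at most \<open>B\<close>, and also at most the
  product of its images under \<open>p\<close> and \<open>q\<close>. The geometric mean of these two
  bounds is summed over the fibres by Cauchy-Schwarz; the image sizes add up to the numbers of pairs
  \<open>(p m, v m)\<close> and \<open>(q m, v m)\<close>.\<close>

lemma card_square_le_fibres:
  fixes p :: "'m \<Rightarrow> 'a" and q :: "'m \<Rightarrow> 'b" and v :: "'m \<Rightarrow> 'v"
  assumes fin: "finite G" and inj: "inj_on (\<lambda>m. (p m, q m)) G"
    and B: "\<And>z. card {m \<in> G. v m = z} \<le> B"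
  shows "(card G)\<^sup>2 \<le> B * card ((\<lambda>m. (p m, v m)) ` G) * card ((\<lambda>m. (q m, v m)) ` G)"
proof -
  define F where "F = (\<lambda>z. {m \<in> G. v m = z})"
  have finF: "finite (F z)" for z using fin by (simp add: F_def)
  have fibre_sum: "card ((\<lambda>m. (h m, v m)) ` G) = (\<Sum>z\<in>v ` G. card (h ` F z))" for h :: "'m \<Rightarrow> 'h"
  proof -
    have "bij_betw prod.swap (SIGMA z:v ` G. h ` F z) ((\<lambda>m. (h m, v m)) ` G)"
      by (intro bij_betwI[where g = prod.swap]) (force simp: F_def)+
    then have "card ((\<lambda>m. (h m, v m)) ` G) = card (SIGMA z:v ` G. h ` F z)"
      by (metis bij_betw_same_card)
    then show ?thesis using fin finF by (simp add: card_SigmaI)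
  qed
  have each: "real (card (F z)) \<le> sqrt B * (sqrt (card (p ` F z)) * sqrt (card (q ` F z)))" for z
  proof -
    have "card (F z) = card ((\<lambda>m. (p m, q m)) ` F z)"
      by (rule card_image[symmetric], rule inj_on_subset[OF inj]) (auto simp: F_def)
    also have "\<dots> \<le> card (p ` F z \<times> q ` F z)"
      by (intro card_mono finite_cartesian_product finite_imageI finF) auto
    finally have "card (F z) \<le> card (p ` F z) * card (q ` F z)" by (simp add: card_cartesian_product)
    moreover have "card (F z) \<le> B" using B by (simp add: F_def)
    ultimately have "(card (F z))\<^sup>2 \<le> B * (card (p ` F z) * card (q ` F z))"
      unfolding power2_eq_square by (simp add: mult_mono)
    then have "(real (card (F z)))\<^sup>2 \<le> real B * (real (card (p ` F z)) * real (card (q ` F z)))"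
      by (metis of_nat_le_iff of_nat_mult of_nat_power)
    then have "real (card (F z)) \<le> sqrt (real B * (real (card (p ` F z)) * real (card (q ` F z))))"
      by (rule real_le_rsqrt)
    then show ?thesis by (simp add: real_sqrt_mult)
  qed
  have G: "G = (\<Union>z\<in>v ` G. F z)" by (auto simp: F_def)
  have "card (\<Union>z\<in>v ` G. F z) = (\<Sum>z\<in>v ` G. card (F z))"
    by (rule card_UN_disjoint) (use fin finF in \<open>auto simp: F_def\<close>)
  then have "card G = (\<Sum>z\<in>v ` G. card (F z))" using G by simp
  then have "real (card G) = (\<Sum>z\<in>v ` G. real (card (F z)))" by simp
  also have "\<dots> \<le> (\<Sum>z\<in>v ` G. sqrt B * (sqrt (card (p ` F z)) * sqrt (card (q ` F z))))"
    by (intro sum_mono each)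
  also have "\<dots> = sqrt B * (\<Sum>z\<in>v ` G. sqrt (card (p ` F z)) * sqrt (card (q ` F z)))"
    by (simp add: sum_distrib_left)
  finally have "(real (card G))\<^sup>2 \<le> (sqrt B * (\<Sum>z\<in>v ` G. sqrt (card (p ` F z)) * sqrt (card (q ` F z))))\<^sup>2"
    by (intro power_mono) auto
  also have "\<dots> = B * (\<Sum>z\<in>v ` G. sqrt (card (p ` F z)) * sqrt (card (q ` F z)))\<^sup>2"
    by (simp add: power_mult_distrib)
  also have "\<dots> \<le> B * ((\<Sum>z\<in>v ` G. (sqrt (card (p ` F z)))\<^sup>2) * (\<Sum>z\<in>v ` G. (sqrt (card (q ` F z)))\<^sup>2))"
    by (intro mult_left_mono Cauchy_Schwarz_ineq_sum) auto
  also have "\<dots> = real (B * card ((\<lambda>m. (p m, v m)) ` G) * card ((\<lambda>m. (q m, v m)) ` G))"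
    by (simp add: fibre_sum)
  finally show ?thesis by (metis of_nat_le_iff of_nat_power)
qed

section \<open>Message sizes and link capacities\<close>

lemma LIMSEQ_zero_if_le:
  fixes f g :: "nat \<Rightarrow> real"
  assumes "\<And>n. 0 \<le> f n" "\<And>n. f n \<le> g n" "g \<longlonglongrightarrow> 0"
  shows "f \<longlonglongrightarrow> 0"
  using tendsto_sandwich[of "\<lambda>_. 0" f sequentially g 0] assms by simp

lemma finite_PP: "finite (PP K)"
  by (rule finite_subset[of _ "Pow {1..K}"]) (auto simp: PP_def)

lemma WW_subset_PP: "WW K i \<subseteq> PP K"
  by (auto simp: WW_def)

lemma msgsize_ge: "2 powr (real n * r) \<le> real (msgsize n r)"
  unfolding msgsize_def by (simp add: real_nat_ceiling_ge)

lemma msgsize_pos: "0 < msgsize n r"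
  unfolding msgsize_def by simp

lemma less_msgsize_iff: "m < msgsize n r \<longleftrightarrow> real m < 2 powr (real n * r)"
  unfolding msgsize_def zless_nat_eq_int_zless less_ceiling_iff by simp

lemma msgsize_minus_1_le: "real (msgsize n r - 1) \<le> 2 powr (real n * r)"
  using less_msgsize_iff[of "msgsize n r - 1" n r] msgsize_pos[of n r] by simp

lemma msgsize_0: "msgsize n 0 = 1"
  by (simp add: msgsize_def)

text \<open>Lets a message of rate \<open>p + q\<close> be split by \<open>mod\<close> and
  \<open>div\<close>: rounding \<open>msgsize n p\<close> up only enlarges the divisor, so the
  quotient stays in the range of rate \<open>q\<close>.\<close>

lemma div_msgsize_less:
  assumes "m < msgsize n (p + q)"
  shows "m div msgsize n p < msgsize n q"
proof -
  have "real (m div msgsize n p) \<le> real m / real (msgsize n p)" by (rule of_nat_div_le_of_nat)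
  also have "\<dots> < 2 powr (real n * (p + q)) / real (msgsize n p)"
    using assms msgsize_pos by (intro divide_strict_right_mono) (auto simp: less_msgsize_iff)
  also have "\<dots> \<le> 2 powr (real n * (p + q)) / 2 powr (real n * p)"
    by (intro divide_left_mono msgsize_ge mult_pos_pos) (auto simp: msgsize_pos)
  also have "\<dots> = 2 powr (real n * q)" by (simp add: powr_diff[symmetric] algebra_simps)
  finally show ?thesis by (simp add: less_msgsize_iff)
qed

text \<open>The right-hand side counts the signals of length \<open>n\<close> on the links in
  \<open>W\<close>; both directions of the proof pass between capacities and counts by this
  identity.\<close>

lemma powr_Csum:
  assumes "\<forall>S\<in>PP K. N S \<ge> 1" "W \<subseteq> PP K"
  shows "2 powr (real n * Csum N W) = (\<Prod>S\<in>W. real (N S ^ n))"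
proof -
  have fin: "finite W" using assms(2) finite_PP finite_subset by blast
  have "2 powr (real n * Csum N W) = 2 powr (\<Sum>S\<in>W. real n * cap N S)"
    by (simp add: Csum_def sum_distrib_left)
  also have "\<dots> = (\<Prod>S\<in>W. 2 powr (real n * cap N S))" by (simp add: powr_sum fin)
  also have "\<dots> = (\<Prod>S\<in>W. real (N S ^ n))"
  proof (rule prod.cong[OF refl])
    fix S assume "S \<in> W"
    then have N: "real (N S) > 0" using assms by fastforce
    have "2 powr (real n * cap N S) = (2 powr cap N S) powr real n"
      by (simp add: powr_powr mult.commute)
    also have "\<dots> = real (N S) ^ n" using N by (simp add: cap_def powr_realpow)
    finally show "2 powr (real n * cap N S) = real (N S ^ n)" by simp
  qed
  finally show ?thesis .
qed

lemma Csum_Un_disjoint: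
  assumes "W \<subseteq> PP K" "W' \<subseteq> PP K" "W \<inter> W' = {}"
  shows "Csum N (W \<union> W') = Csum N W + Csum N W'"
  unfolding Csum_def
  by (rule sum.union_disjoint[OF assms(1,2)[THEN finite_subset[OF _ finite_PP]] assms(3)])

lemma Csum_mono:
  assumes "\<forall>S\<in>PP K. N S \<ge> 1" "W \<subseteq> W'" "W' \<subseteq> PP K"
  shows "Csum N W \<le> Csum N W'"
  unfolding Csum_def
proof (rule sum_mono2)
  show "finite W'" using assms finite_PP[of K] finite_subset by blast
  show "0 \<le> cap N S" if "S \<in> W' - W" for S
  proof -
    have "N S \<ge> 1" using that assms by blast
    then show ?thesis by (simp add: cap_def)
  qed
qed (fact assms)

lemma finite_msgset: "finite Ms \<Longrightarrow> finite (msgset Ms R n)"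
  unfolding msgset_def by (intro finite_PiE) auto

lemma card_msgset2:
  assumes "A1 \<noteq> A2"
  shows "card (msgset {A1, A2} R n) = msgsize n (R A1) * msgsize n (R A2)"
  using assms by (simp add: msgset_def card_PiE)

section \<open>Achievability by rate splitting\<close>

text \<open>Parts 0 and 1 form the first message, parts 2 and 3 the second. The strict inequality
  \<open>hall\<close> makes every term of the union bound in \<open>random_code\<close> decay
  exponentially in \<open>n\<close>.\<close>

lemma achievable_by_splitting:
  fixes q :: "nat \<Rightarrow> real" and E :: "nat set \<Rightarrow> nat set" and D :: "nat \<Rightarrow> nat set"
  assumes N: "\<forall>S\<in>PP K. N S \<ge> 1" and A: "A1 \<noteq> A2" and fin: "finite A1" "finite A2"
    and q0: "\<And>g. 0 \<le> q g"
    and E4: "\<And>S. S \<in> PP K \<Longrightarrow> E S \<subseteq> {..<4}" and D4: "\<And>i. i \<in> A1 \<union> A2 \<Longrightarrow> D i \<subseteq> {..<4}"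
    and ED: "\<And>i S. i \<in> A1 \<union> A2 \<Longrightarrow> S \<in> WW K i \<Longrightarrow> E S \<subseteq> D i"
    and D1: "\<And>i. i \<in> A1 \<Longrightarrow> {0, 1} \<subseteq> D i" and D2: "\<And>i. i \<in> A2 \<Longrightarrow> {2, 3} \<subseteq> D i"
    and hall: "\<And>i F. i \<in> A1 \<union> A2 \<Longrightarrow> F \<subseteq> D i \<Longrightarrow> F \<noteq> {} \<Longrightarrow> (\<And>g. g \<in> F \<Longrightarrow> 0 < q g) \<Longrightarrow>
        sum q F < Csum N {S \<in> WW K i. E S \<inter> F \<noteq> {}}"
  shows "achievable K N {A1, A2} (\<lambda>A. if A = A1 then q 0 + q 1 else q 2 + q 3)"
proof -
  define R where "R = (\<lambda>A. if A = A1 then q 0 + q 1 else q 2 + q 3)"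
  have R: "R A1 = q 0 + q 1" "R A2 = q 2 + q 3" using A by (auto simp: R_def)
  define \<epsilon> where "\<epsilon> = (\<lambda>n. \<Sum>i\<in>A1 \<union> A2. \<Sum>F\<in>Pow (D i) - {{}}.
     (\<Prod>g\<in>F. real (msgsize n (q g) - 1)) / (\<Prod>S\<in>{S \<in> WW K i. E S \<inter> F \<noteq> {}}. real (N S ^ n)))"
  have code: "\<exists>enc dec. valid_encoder K N {A1, A2} R n enc \<and> perr K {A1, A2} R n enc dec \<le> \<epsilon> n" for n
  proof -
    define M where "M = msgset {A1, A2} R n"
    define X where "X = (\<lambda>g. msgsize n (q g))"
    define u where "u = (\<lambda>m :: nat set \<Rightarrow> nat. \<lambda>g\<in>{..<4::nat}. if g = 0 then m A1 mod X 0 else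
       if g = 1 then m A1 div X 0 else if g = 2 then m A2 mod X 2 else m A2 div X 2)"
    define V where "V = (\<lambda>S. PiE {..<n} (\<lambda>_. {..<N S}))"
    have finM: "finite M" by (simp add: M_def finite_msgset)
    have cardV: "card (V S) = N S ^ n" for S by (simp add: V_def card_PiE)
    have uU: "u m \<in> PiE {..<4} (\<lambda>g. {..<X g})" if "m \<in> M" for m
    proof -
      have "m A1 < msgsize n (q 0 + q 1)" "m A2 < msgsize n (q 2 + q 3)"
        using that A unfolding R[symmetric] by (auto simp: M_def msgset_def PiE_iff)
      then have "m A1 div X 0 < X 1" "m A2 div X 2 < X 3"
        by (auto simp: X_def intro: div_msgsize_less)
      moreover have "X g > 0" for g by (simp add: X_def msgsize_pos)
      ultimately have "u m 0 < X 0" "u m 1 < X 1" "u m 2 < X 2" "u m 3 < X 3"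
        by (simp_all add: u_def)
      moreover have "{..<4} = {0, 1, 2, 3 :: nat}" by auto
      moreover have "u m \<in> extensional {..<4}" by (simp add: u_def)
      ultimately show ?thesis by (simp add: PiE_iff)
    qed
    have u1: "m A1 = m' A1" if "u m 0 = u m' 0" "u m 1 = u m' 1" for m m'
    proof -
      have "m A1 mod X 0 = m' A1 mod X 0" "m A1 div X 0 = m' A1 div X 0"
        using that by (simp_all add: u_def)
      then show ?thesis by (metis div_mult_mod_eq)
    qed
    have u2: "m A2 = m' A2" if "u m 2 = u m' 2" "u m 3 = u m' 3" for m m'
    proof -
      have "m A2 mod X 2 = m' A2 mod X 2" "m A2 div X 2 = m' A2 div X 2"
        using that by (simp_all add: u_def)
      then show ?thesis by (metis div_mult_mod_eq)
    qed
    define U where "U = PiE {..<4} (\<lambda>g. {..<X g})"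
    define bad where "bad = (\<lambda>c :: nat set \<Rightarrow> (nat \<Rightarrow> nat) \<Rightarrow> nat \<Rightarrow> nat. {m \<in> M. \<exists>i\<in>A1 \<union> A2. \<exists>w\<in>U. (\<exists>g\<in>D i. w g \<noteq> u m g) \<and>
       (\<forall>S\<in>WW K i. c S (restrict (u m) (E S)) = c S (restrict w (E S)))})"
    have \<epsilon>: "\<epsilon> n = (\<Sum>i\<in>A1 \<union> A2. \<Sum>F\<in>Pow (D i) - {{}}.
        (\<Prod>g\<in>F. real (X g - 1)) / (\<Prod>S\<in>{S \<in> WW K i. E S \<inter> F \<noteq> {}}. real (card (V S))))"
      by (simp add: \<epsilon>_def X_def cardV)
    have "\<exists>c. (\<forall>S\<in>PP K. \<forall>w\<in>U. c S (restrict w (E S)) \<in> V S) \<and> real (card (bad c)) \<le> real (card M) * \<epsilon> n"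
      unfolding \<epsilon> bad_def U_def
    proof (rule random_code)
      show "V S \<noteq> {}" if "S \<in> PP K" for S
        using that N by (fastforce simp: V_def PiE_eq_empty_iff lessThan_empty_iff)
      show "finite (V S)" for S by (auto simp: V_def intro: finite_PiE)
      show "finite (A1 \<union> A2)" using fin by simp
    qed (fact finite_PP finite_lessThan finM uU D4 ED E4 | rule WW_subset_PP)+
    then obtain c where cV: "\<And>S w. S \<in> PP K \<Longrightarrow> w \<in> U \<Longrightarrow> c S (restrict w (E S)) \<in> V S"
      and c: "real (card (bad c)) \<le> real (card M) * \<epsilon> n" by blast
    define enc where "enc = (\<lambda>m S. c S (restrict (u m) (E S)))"
    \<comment> \<open>The decoder returns any message consistent with the output. It may be wrong in
      parts outside \<open>D i\<close>; an error in a demanded message forces a difference inside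
      \<open>D i\<close>, which is what \<open>bad\<close> records.\<close>
    define dec where "dec = (\<lambda>i y. SOME m'. m' \<in> M \<and> obs K n enc i m' = y)"
    have encV: "enc m S \<in> V S" if "m \<in> M" "S \<in> PP K" for m S
      using cV[OF that(2)] uU[OF that(1)] by (simp add: enc_def U_def)
    have valid: "valid_encoder K N {A1, A2} R n enc"
      using encV by (fastforce simp: valid_encoder_def M_def V_def)
    have sub: "{m \<in> M. err_event K {A1, A2} n enc dec m} \<subseteq> bad c"
    proof clarify
      fix m assume m: "m \<in> M" and err: "err_event K {A1, A2} n enc dec m"
      then obtain B i where B: "B \<in> {A1, A2}" and i: "i \<in> B"
        and ne: "dec i (obs K n enc i m) B \<noteq> m B" by (auto simp: err_event_def)
      define m' where "m' = dec i (obs K n enc i m)"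
      have "m' \<in> M \<and> obs K n enc i m' = obs K n enc i m"
        unfolding m'_def dec_def by (rule someI[of _ m]) (use m in auto)
      then have m': "m' \<in> M" and o: "obs K n enc i m' = obs K n enc i m" by auto
      have "enc m S = enc m' S" if S: "S \<in> WW K i" for S
      proof (rule PiE_ext)
        show "enc m S \<in> PiE {..<n} (\<lambda>_. {..<N S})" "enc m' S \<in> PiE {..<n} (\<lambda>_. {..<N S})"
          using encV[OF m, of S] encV[OF m', of S] S unfolding V_def WW_def by blast+
        show "enc m S t = enc m' S t" if "t \<in> {..<n}" for t
          using fun_cong[OF fun_cong[OF o, of S], of t] S that by (simp add: obs_def)
      qed
      moreover have "\<exists>g\<in>D i. u m' g \<noteq> u m g"
      proof (rule ccontr)
        assume "\<not> ?thesis"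
        then have "m' B = m B" using B i D1 D2 u1[of m' m] u2[of m' m] by auto
        then show False using ne by (simp add: m'_def)
      qed
      moreover have "u m' \<in> U" using uU[OF m'] by (simp add: U_def)
      moreover have "i \<in> A1 \<union> A2" using B i by blast
      ultimately show "m \<in> bad c" using m unfolding bad_def enc_def by blast
    qed
    have "finite (bad c)" using finM by (simp add: bad_def)
    from card_mono[OF this sub]
    have "real (card {m \<in> M. err_event K {A1, A2} n enc dec m}) \<le> real (card M) * \<epsilon> n"
      using c by linarith
    moreover have "card M > 0" by (simp add: M_def card_msgset2[OF A] msgsize_pos)
    ultimately have "perr K {A1, A2} R n enc dec \<le> \<epsilon> n"
      by (simp add: perr_def M_def[symmetric] field_simps)
    then show ?thesis using valid by blast
  qed
  have lim: "\<epsilon> \<longlonglongrightarrow> 0" unfolding \<epsilon>_def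
  proof (rule tendsto_null_sum, rule tendsto_null_sum)
    fix i F assume i: "i \<in> A1 \<union> A2" and F: "F \<in> Pow (D i) - {{}}"
    have "F \<subseteq> {..<4}" using F D4[OF i] by blast
    then have finF: "finite F" by (rule finite_subset) simp
    define W where "W = {S \<in> WW K i. E S \<inter> F \<noteq> {}}"
    have W: "(\<Prod>S\<in>W. real (N S ^ n)) = 2 powr (real n * Csum N W)" for n
      by (rule powr_Csum[OF N, symmetric]) (auto simp: W_def WW_def)
    show "(\<lambda>n. (\<Prod>g\<in>F. real (msgsize n (q g) - 1)) /
        (\<Prod>S\<in>{S \<in> WW K i. E S \<inter> F \<noteq> {}}. real (N S ^ n))) \<longlonglongrightarrow> 0"
    \<comment> \<open>A part of rate zero has \<open>msgsize\<close> 1 and hence no wrong value: its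
      factor is exactly 0. This leaves to \<open>hall\<close> the sets \<open>F\<close> with all
      rates positive.\<close>
    proof (cases "\<exists>g\<in>F. q g = 0")
      case True
      then have "(\<Prod>g\<in>F. real (msgsize n (q g) - 1)) = 0" for n
        using finF by (force simp: msgsize_0)
      then show ?thesis by simp
    next
      case False
      then have lt: "sum q F < Csum N W"
        unfolding W_def using F q0 by (intro hall[OF i]) (auto simp: less_le)
      define x where "x = 2 powr (sum q F - Csum N W)"
      have ub: "(\<Prod>g\<in>F. real (msgsize n (q g) - 1)) / (\<Prod>S\<in>W. real (N S ^ n)) \<le> x ^ n" for n
      proof -
        have "(\<Prod>g\<in>F. real (msgsize n (q g) - 1)) \<le> (\<Prod>g\<in>F. 2 powr (real n * q g))"
          by (intro prod_mono conjI msgsize_minus_1_le) auto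
        also have "\<dots> = 2 powr (real n * sum q F)"
          using finF by (simp add: powr_sum sum_distrib_left)
        finally have "(\<Prod>g\<in>F. real (msgsize n (q g) - 1)) / 2 powr (real n * Csum N W)
            \<le> 2 powr (real n * sum q F) / 2 powr (real n * Csum N W)"
          by (rule divide_right_mono) simp
        also have "\<dots> = 2 powr (real n * (sum q F - Csum N W))"
          by (simp add: powr_diff[symmetric] algebra_simps)
        also have "\<dots> = x ^ n"
          by (simp add: x_def powr_realpow[symmetric] powr_powr mult.commute)
        finally show ?thesis unfolding W .
      qed
      have lim: "(\<lambda>n. x ^ n) \<longlonglongrightarrow> 0"
        using lt by (intro LIMSEQ_power_zero) (auto simp: x_def powr_less_one)
      have nn: "0 \<le> (\<Prod>g\<in>F. real (msgsize n (q g) - 1)) / (\<Prod>S\<in>W. real (N S ^ n))" for n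
        by (intro divide_nonneg_nonneg prod_nonneg) auto
      have "(\<lambda>n. (\<Prod>g\<in>F. real (msgsize n (q g) - 1)) / (\<Prod>S\<in>W. real (N S ^ n))) \<longlonglongrightarrow> 0"
        by (rule LIMSEQ_zero_if_le[OF nn ub lim])
      then show ?thesis by (simp add: W_def)
    qed
  qed
  obtain enc dec where valid: "\<And>n. valid_encoder K N {A1, A2} R n (enc n)"
    and ub: "\<And>n. perr K {A1, A2} R n (enc n) (dec n) \<le> \<epsilon> n"
    using code by metis
  have nn: "0 \<le> perr K {A1, A2} R n (enc n) (dec n)" for n by (simp add: perr_def)
  have "(\<lambda>n. perr K {A1, A2} R n (enc n) (dec n)) \<longlonglongrightarrow> 0"
    by (rule LIMSEQ_zero_if_le[OF nn ub lim])
  moreover have "\<forall>A\<in>{A1, A2}. 0 \<le> R A" using q0 by (simp add: R_def)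
  ultimately show ?thesis unfolding achievable_def R_def[symmetric] using valid by blast
qed

section \<open>Converse by counting\<close>

text \<open>On \<open>G\<close> the function \<open>h\<close> factors through the signals on the
  links in \<open>W\<close>, so it has at most as many values as there are such signals.\<close>

lemma card_image_le_links:
  assumes N: "\<forall>S\<in>PP K. N S \<ge> 1" and valid: "valid_encoder K N Ms R n enc"
    and G: "G \<subseteq> msgset Ms R n" "finite G" and W: "W \<subseteq> PP K"
    and det: "\<And>m m'. m \<in> G \<Longrightarrow> m' \<in> G \<Longrightarrow> (\<And>S t. S \<in> W \<Longrightarrow> t < n \<Longrightarrow> enc m S t = enc m' S t) \<Longrightarrow> h m = h m'"
  shows "real (card (h ` G)) \<le> 2 powr (real n * Csum N W)"
proof -
  define view where "view = (\<lambda>m. \<lambda>S\<in>W. \<lambda>t\<in>{..<n}. enc m S t)"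
  define V where "V = PiE W (\<lambda>S. PiE {..<n} (\<lambda>_. {..<N S}))"
  have finW: "finite W" using W finite_PP finite_subset by blast
  have finV: "finite V" unfolding V_def using finW by (intro finite_PiE) auto
  have viewV: "view ` G \<subseteq> V"
  proof clarify
    fix m assume "m \<in> G"
    then have "enc m S t < N S" if "S \<in> W" "t < n" for S t
      using that valid G W unfolding valid_encoder_def by blast
    then show "view m \<in> V" by (auto simp: view_def V_def)
  qed
  have hv: "h m = h m'" if "m \<in> G" "m' \<in> G" "view m = view m'" for m m'
  proof (rule det[OF that(1,2)])
    fix S t assume "S \<in> W" "t < n"
    then show "enc m S t = enc m' S t"
      using fun_cong[OF fun_cong[OF that(3), of S], of t] by (simp add: view_def)
  qed
  have "h ` G \<subseteq> (\<lambda>v. h (SOME m. m \<in> G \<and> view m = v)) ` view ` G"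
  proof
    fix y assume "y \<in> h ` G"
    then obtain m where m: "m \<in> G" "y = h m" by blast
    have "(SOME m'. m' \<in> G \<and> view m' = view m) \<in> G \<and> view (SOME m'. m' \<in> G \<and> view m' = view m) = view m"
      by (rule someI[of _ m]) (use m in auto)
    then have "y = h (SOME m'. m' \<in> G \<and> view m' = view m)" using m hv by metis
    then show "y \<in> (\<lambda>v. h (SOME m. m \<in> G \<and> view m = v)) ` view ` G" using m by blast
  qed
  then have "card (h ` G) \<le> card (view ` G)" using G(2) by (meson finite_imageI surj_card_le)
  also have "\<dots> \<le> card V" using finV viewV by (rule card_mono)
  also have "card V = (\<Prod>S\<in>W. N S ^ n)" using finW by (simp add: V_def card_PiE)
  finally have "real (card (h ` G)) \<le> real (\<Prod>S\<in>W. N S ^ n)" by (rule of_nat_mono)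
  then show ?thesis by (simp add: powr_Csum[OF N W])
qed

text \<open>On these messages every output determines the demanded messages exactly, so that
  counting can take the place of Fano's inequality.\<close>

definition good :: "nat \<Rightarrow> nat set set \<Rightarrow> (nat set \<Rightarrow> real) \<Rightarrow> nat
    \<Rightarrow> ((nat set \<Rightarrow> nat) \<Rightarrow> nat set \<Rightarrow> nat \<Rightarrow> nat)
    \<Rightarrow> (nat \<Rightarrow> (nat set \<Rightarrow> nat \<Rightarrow> nat) \<Rightarrow> nat set \<Rightarrow> nat)
    \<Rightarrow> (nat set \<Rightarrow> nat) set" where
  "good K Ms R n enc dec = {m \<in> msgset Ms R n. \<not> err_event K Ms n enc dec m}"

lemma good_decode:
  assumes "m \<in> good K Ms R n enc dec" "m' \<in> good K Ms R n enc dec" "A \<in> Ms" "i \<in> A"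
    and "\<forall>S\<in>WW K i. \<forall>t<n. enc m S t = enc m' S t"
  shows "m A = m' A"
proof -
  have "obs K n enc i m = obs K n enc i m'" using assms(5) by (auto simp: obs_def fun_eq_iff)
  moreover have "dec i (obs K n enc i m) A = m A" "dec i (obs K n enc i m') A = m' A"
    using assms by (auto simp: good_def err_event_def)
  ultimately show ?thesis by simp
qed

lemma good_inj: "inj_on (\<lambda>m. (m A1, m A2)) (good K {A1, A2} R n enc dec)"
proof (rule inj_onI)
  fix m m' assume "m \<in> good K {A1, A2} R n enc dec" "m' \<in> good K {A1, A2} R n enc dec"
    and "(m A1, m A2) = (m' A1, m' A2)"
  then show "m = m'" unfolding good_def msgset_def
    by (intro PiE_ext[of m "{A1, A2}" _ m']) auto
qed

lemma good_card_ge: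
  assumes "A1 \<noteq> A2" "perr K {A1, A2} R n enc dec < 1 / 2"
  shows "real (msgsize n (R A1)) * real (msgsize n (R A2)) \<le> 2 * real (card (good K {A1, A2} R n enc dec))"
proof -
  define M where "M = msgset {A1, A2} R n"
  define B where "B = {m \<in> M. err_event K {A1, A2} n enc dec m}"
  have cM: "card M = msgsize n (R A1) * msgsize n (R A2)" by (simp add: M_def card_msgset2 assms)
  have "card M > 0" by (simp add: cM msgsize_pos)
  then have "2 * real (card B) < card M"
    using assms(2) by (simp add: perr_def M_def[symmetric] B_def[symmetric] field_simps)
  moreover have "card M = card B + card (good K {A1, A2} R n enc dec)"
  proof -
    have "M = B \<union> good K {A1, A2} R n enc dec" by (auto simp: M_def B_def good_def)
    moreover have "finite M" by (simp add: M_def finite_msgset)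
    ultimately show ?thesis
      by (metis (no_types, lifting) B_def card_Un_disjoint disjoint_iff finite_Un good_def mem_Collect_eq)
  qed
  ultimately show ?thesis unfolding of_nat_mult[symmetric] cM[symmetric] by linarith
qed

context
  fixes K N A1 A2 R n enc dec G
  assumes N: "\<forall>S\<in>PP K. N S \<ge> 1" and A: "A1 \<noteq> A2" and valid: "valid_encoder K N {A1, A2} R n enc"
  defines "G \<equiv> good K {A1, A2} R n enc dec"
begin

lemma good_finite: "finite G"
  unfolding G_def good_def using finite_msgset by (auto intro: finite_subset)

text \<open>The second message is left to range over all its values, so that its size cancels
  against the lower bound in \<open>good_card_ge\<close>.\<close>

lemma good_card_le_single:
  assumes "i \<in> A1"
  shows "real (card G) \<le> 2 powr (real n * Csum N (WW K i)) * real (msgsize n (R A2))"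
proof -
  have "card G = card ((\<lambda>m. (m A1, m A2)) ` G)"
    unfolding G_def by (rule card_image[OF good_inj, symmetric])
  also have "\<dots> \<le> card ((\<lambda>m. m A1) ` G \<times> {..<msgsize n (R A2)})"
    using good_finite by (intro card_mono) (auto simp: G_def good_def msgset_def)
  finally have "real (card G) \<le> real (card ((\<lambda>m. m A1) ` G)) * real (msgsize n (R A2))"
    by (simp add: card_cartesian_product flip: of_nat_mult)
  also have "\<dots> \<le> 2 powr (real n * Csum N (WW K i)) * real (msgsize n (R A2))"
  proof (intro mult_right_mono card_image_le_links[OF N valid _ good_finite WW_subset_PP])
    fix m m' assume m: "m \<in> G" "m' \<in> G" "\<And>S t. S \<in> WW K i \<Longrightarrow> t < n \<Longrightarrow> enc m S t = enc m' S t"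
    show "m A1 = m' A1"
      by (rule good_decode[OF m(1,2)[unfolded G_def] _ assms]) (use m(3) in auto)
  qed (auto simp: G_def good_def)
  finally show ?thesis .
qed

text \<open>Receivers \<open>i\<close> and \<open>k\<close> together recover both messages. The case
  \<open>i = k\<close> is a receiver that demands both.\<close>

lemma good_card_le_pair:
  assumes "i \<in> A1" "k \<in> A2"
  shows "real (card G) \<le> 2 powr (real n * Csum N (WW K i \<union> WW K k))"
proof -
  have "real (card ((\<lambda>m. (m A1, m A2)) ` G)) \<le> 2 powr (real n * Csum N (WW K i \<union> WW K k))"
  proof (intro card_image_le_links[OF N valid _ good_finite])
    fix m m' assume m: "m \<in> G" "m' \<in> G" "\<And>S t. S \<in> WW K i \<union> WW K k \<Longrightarrow> t < n \<Longrightarrow> enc m S t = enc m' S t"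
    have "m A1 = m' A1"
      by (rule good_decode[OF m(1,2)[unfolded G_def] _ assms(1)]) (use m(3) in auto)
    moreover have "m A2 = m' A2"
      by (rule good_decode[OF m(1,2)[unfolded G_def] _ assms(2)]) (use m(3) in auto)
    ultimately show "(m A1, m A2) = (m' A1, m' A2)" by simp
  qed (auto simp: G_def good_def WW_def)
  then show ?thesis by (simp add: card_image G_def good_inj)
qed

lemma good_card_square_le:
  assumes i: "i \<in> A1" and k: "k \<in> A2" and j: "j \<in> A1" "j \<in> A2"
  shows "(real (card G))\<^sup>2 \<le> 2 powr (real n *
    (Csum N (WW K j - (WW K i \<inter> WW K k)) + Csum N (WW K i) + Csum N (WW K k)))"
proof -
  \<comment> \<open>The signals on the common links are determined by the output of \<open>i\<close>
    as well as by that of \<open>k\<close>, so adding \<open>v\<close> to a decoded message costs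
    neither receiver anything.\<close>
  define v where "v = (\<lambda>m. \<lambda>S\<in>WW K i \<inter> WW K k. \<lambda>t\<in>{..<n}. enc m S t)"
  define L where "L = (\<lambda>W. 2 powr (real n * Csum N W))"
  define W where "W = WW K j - (WW K i \<inter> WW K k)"
  have GM: "G \<subseteq> msgset {A1, A2} R n" by (auto simp: G_def good_def)
  have veq: "v m = v m'" if "\<And>S t. S \<in> WW K i \<inter> WW K k \<Longrightarrow> t < n \<Longrightarrow> enc m S t = enc m' S t" for m m'
    using that by (auto simp: v_def fun_eq_iff restrict_def)
  have p: "real (card ((\<lambda>m. (m A1, v m)) ` G)) \<le> L (WW K i)" unfolding L_def
  proof (intro card_image_le_links[OF N valid GM good_finite WW_subset_PP])
    fix m m' assume m: "m \<in> G" "m' \<in> G" "\<And>S t. S \<in> WW K i \<Longrightarrow> t < n \<Longrightarrow> enc m S t = enc m' S t"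
    have "m A1 = m' A1"
      by (rule good_decode[OF m(1,2)[unfolded G_def] _ i]) (use m(3) in auto)
    moreover have "v m = v m'" using m(3) by (intro veq) auto
    ultimately show "(m A1, v m) = (m' A1, v m')" by simp
  qed
  have q: "real (card ((\<lambda>m. (m A2, v m)) ` G)) \<le> L (WW K k)" unfolding L_def
  proof (intro card_image_le_links[OF N valid GM good_finite WW_subset_PP])
    fix m m' assume m: "m \<in> G" "m' \<in> G" "\<And>S t. S \<in> WW K k \<Longrightarrow> t < n \<Longrightarrow> enc m S t = enc m' S t"
    have "m A2 = m' A2"
      by (rule good_decode[OF m(1,2)[unfolded G_def] _ k]) (use m(3) in auto)
    moreover have "v m = v m'" using m(3) by (intro veq) auto
    ultimately show "(m A2, v m) = (m' A2, v m')" by simp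
  qed
  \<comment> \<open>Within a fibre the common links are constant; the links in \<open>W\<close> are
    all that is left for \<open>j\<close>, which recovers both messages.\<close>
  have B: "real (card {m \<in> G. v m = z}) \<le> L W" for z
  proof -
    have "real (card ((\<lambda>m. (m A1, m A2)) ` {m \<in> G. v m = z})) \<le> L W" unfolding L_def
    proof (intro card_image_le_links[OF N valid])
      fix m m' assume m: "m \<in> {m \<in> G. v m = z}" "m' \<in> {m \<in> G. v m = z}"
        and eqW: "\<And>S t. S \<in> W \<Longrightarrow> t < n \<Longrightarrow> enc m S t = enc m' S t"
      have mG: "m \<in> G" "m' \<in> G" using m by auto
      have eq: "enc m S t = enc m' S t" if "S \<in> WW K j" "t < n" for S t
      proof (cases "S \<in> W")
        case False
        then have S: "S \<in> WW K i" "S \<in> WW K k" using that by (auto simp: W_def)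
        have "v m S t = v m' S t" using m by simp
        then show ?thesis using S that by (simp add: v_def)
      qed (use eqW that in blast)
      have "m A1 = m' A1"
        by (rule good_decode[OF mG[unfolded G_def] _ j(1)]) (use eq in auto)
      moreover have "m A2 = m' A2"
        by (rule good_decode[OF mG[unfolded G_def] _ j(2)]) (use eq in auto)
      ultimately show "(m A1, m A2) = (m' A1, m' A2)" by simp
    qed (use GM good_finite in \<open>auto simp: W_def WW_def\<close>)
    moreover have "inj_on (\<lambda>m. (m A1, m A2)) {m \<in> G. v m = z}"
      using good_inj unfolding G_def by (rule inj_on_subset) auto
    ultimately show ?thesis by (simp add: card_image)
  qed
  \<comment> \<open>The fibre bound has to be a natural number; rounding down is harmless because
    cardinalities are integers.\<close>
  have "(card G)\<^sup>2 \<le> nat \<lfloor>L W\<rfloor> * card ((\<lambda>m. (m A1, v m)) ` G) * card ((\<lambda>m. (m A2, v m)) ` G)"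
    using B by (intro card_square_le_fibres good_finite) (auto simp: G_def good_inj le_nat_floor)
  then have "real ((card G)\<^sup>2) \<le> real (nat \<lfloor>L W\<rfloor> * card ((\<lambda>m. (m A1, v m)) ` G) * card ((\<lambda>m. (m A2, v m)) ` G))"
    by (rule of_nat_mono)
  also have "\<dots> \<le> L W * L (WW K i) * L (WW K k)"
    unfolding of_nat_mult by (intro mult_mono p q) (auto simp: L_def)
  finally show ?thesis by (simp add: L_def W_def powr_add[symmetric] algebra_simps)
qed

end

text \<open>A constant factor does not change an exponential growth rate. The 4 covers the factor 2
  lost by passing to \<open>good\<close>, which gets squared in the third bound of
  \<open>achievable_bounds\<close>.\<close>

lemma le_of_powr_le:
  assumes "\<forall>\<^sub>F n in sequentially. 2 powr (real n * x) \<le> 4 * 2 powr (real n * y)"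
  shows "x \<le> y"
proof (rule ccontr)
  assume "\<not> x \<le> y"
  then have "filterlim (\<lambda>n. real n * (x - y)) at_top sequentially"
    using filterlim_tendsto_pos_mult_at_top[OF tendsto_const[of "x - y"] _ filterlim_real_sequentially]
    by (simp add: mult.commute)
  then have "\<forall>\<^sub>F n in sequentially. real n * (x - y) > 2"
    by (simp add: filterlim_at_top_dense)
  with assms have "\<forall>\<^sub>F n in sequentially. False"
  proof eventually_elim
    case (elim n)
    have "4 * 2 powr (real n * y) = 2 powr (2 + real n * y)" by (simp add: powr_add)
    then show False using elim by (simp add: algebra_simps)
  qed
  then show False by simp
qed

lemma achievable_bounds:
  assumes N: "\<forall>S\<in>PP K. N S \<ge> 1" and A: "A1 \<noteq> A2" and ach: "achievable K N {A1, A2} R"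
  shows "i \<in> A1 \<Longrightarrow> R A1 \<le> Csum N (WW K i)"
    and "i \<in> A1 \<Longrightarrow> k \<in> A2 \<Longrightarrow> R A1 + R A2 \<le> Csum N (WW K i \<union> WW K k)"
    and "i \<in> A1 \<Longrightarrow> k \<in> A2 \<Longrightarrow> j \<in> A1 \<Longrightarrow> j \<in> A2 \<Longrightarrow> 2 * (R A1 + R A2) \<le>
        Csum N (WW K j - (WW K i \<inter> WW K k)) + Csum N (WW K i) + Csum N (WW K k)"
proof -
  obtain enc dec where valid: "\<And>n. valid_encoder K N {A1, A2} R n (enc n)"
    and lim: "(\<lambda>n. perr K {A1, A2} R n (enc n) (dec n)) \<longlonglongrightarrow> 0"
    using ach unfolding achievable_def by blast
  define G where "G = (\<lambda>n. good K {A1, A2} R n (enc n) (dec n))"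
  have "\<forall>\<^sub>F n in sequentially. perr K {A1, A2} R n (enc n) (dec n) < 1 / 2"
    by (rule order_tendstoD(2)[OF lim]) simp
  then have ev: "\<forall>\<^sub>F n in sequentially. real (msgsize n (R A1)) * real (msgsize n (R A2)) \<le> 2 * real (card (G n))"
    by eventually_elim (simp add: G_def good_card_ge[OF A])
  have ev2: "\<forall>\<^sub>F n in sequentially. 2 powr (real n * (R A1 + R A2)) \<le> 2 * real (card (G n))"
    using ev
  proof eventually_elim
    case (elim n)
    have "2 powr (real n * (R A1 + R A2)) = 2 powr (real n * R A1) * 2 powr (real n * R A2)"
      by (simp add: powr_add algebra_simps)
    also have "\<dots> \<le> real (msgsize n (R A1)) * real (msgsize n (R A2))"
      by (intro mult_mono msgsize_ge) auto
    finally show ?case using elim by linarith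
  qed
  show "R A1 \<le> Csum N (WW K i)" if "i \<in> A1"
  proof (rule le_of_powr_le)
    show "\<forall>\<^sub>F n in sequentially. 2 powr (real n * R A1) \<le> 4 * 2 powr (real n * Csum N (WW K i))"
      using ev
    proof eventually_elim
      case (elim n)
      then have "real (msgsize n (R A1)) * real (msgsize n (R A2)) \<le>
          2 * 2 powr (real n * Csum N (WW K i)) * real (msgsize n (R A2))"
        using good_card_le_single[OF N A valid that, of n "dec n"] by (simp add: G_def)
      then have "real (msgsize n (R A1)) \<le> 2 * 2 powr (real n * Csum N (WW K i))"
        using msgsize_pos[of n "R A2"] by simp
      moreover have "0 \<le> 2 powr (real n * Csum N (WW K i))" by simp
      ultimately show ?case using msgsize_ge[of n "R A1"] by linarith
    qed
  qed
  show "R A1 + R A2 \<le> Csum N (WW K i \<union> WW K k)" if "i \<in> A1" "k \<in> A2"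
  proof (rule le_of_powr_le)
    show "\<forall>\<^sub>F n in sequentially. 2 powr (real n * (R A1 + R A2)) \<le> 4 * 2 powr (real n * Csum N (WW K i \<union> WW K k))"
      using ev2
    proof eventually_elim
      case (elim n)
      then show ?case using good_card_le_pair[OF N A valid that, of n "dec n"] by (simp add: G_def)
    qed
  qed
  show "2 * (R A1 + R A2) \<le> Csum N (WW K j - (WW K i \<inter> WW K k)) + Csum N (WW K i) + Csum N (WW K k)"
    if "i \<in> A1" "k \<in> A2" "j \<in> A1" "j \<in> A2"
  proof (rule le_of_powr_le)
    show "\<forall>\<^sub>F n in sequentially. 2 powr (real n * (2 * (R A1 + R A2))) \<le> 4 * 2 powr (real n *
        (Csum N (WW K j - (WW K i \<inter> WW K k)) + Csum N (WW K i) + Csum N (WW K k)))"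
      using ev2
    proof eventually_elim
      case (elim n)
      have "2 powr (real n * (2 * (R A1 + R A2))) = (2 powr (real n * (R A1 + R A2)))\<^sup>2"
        by (simp add: power2_eq_square powr_add[symmetric] algebra_simps)
      also have "\<dots> \<le> (2 * real (card (G n)))\<^sup>2" using elim by (intro power_mono) auto
      also have "\<dots> = 4 * (real (card (G n)))\<^sup>2" by (simp add: power_mult_distrib)
      also have "\<dots> \<le> 4 * 2 powr (real n *
        (Csum N (WW K j - (WW K i \<inter> WW K k)) + Csum N (WW K i) + Csum N (WW K k)))"
        using good_card_square_le[OF N A valid that, of n "dec n"] by (simp add: G_def)
      finally show ?case .
    qed
  qed
qed

section \<open>Link sets, choice of the split, and the region\<close>

lemma cmpl_single_neq: "a \<in> {1..K} \<Longrightarrow> a \<noteq> b \<Longrightarrow> cmpl K {b} \<noteq> cmpl K {a}"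
  unfolding cmpl_def by blast

lemma down_WW_single:
  assumes "b \<in> {1..K}"
  shows "down (WW K a) {cmpl K {b}} = WW K a - WW K b"
  using assms by (auto simp: down_def WW_def PP_def cmpl_def)

text \<open>A link avoids \<open>a\<close> or avoids \<open>b\<close> exactly when it is not seen by
  both; this is the set of remaining links of \<open>j\<close> in the converse.\<close>

lemma down_WW_pair:
  assumes "a \<in> {1..K}" "b \<in> {1..K}"
  shows "down (WW K j) {cmpl K {a}, cmpl K {b}} = WW K j - (WW K b \<inter> WW K a)"
  using assms by (auto simp: down_def WW_def PP_def cmpl_def)

text \<open>
  The parts 0, 1, 2, 3 are \<open>P\<^sub>1, Q\<^sub>1, P\<^sub>2, Q\<^sub>2\<close>. Receiver \<open>b\<close> must not see \<open>Q\<^sub>1\<close>, nor \<open>a\<close> see \<open>Q\<^sub>2\<close>; each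
  link carries a function of all parts that its receivers may see.
\<close>
definition link_parts :: "nat \<Rightarrow> nat \<Rightarrow> nat set \<Rightarrow> nat set" where
  "link_parts a b S = {0, 2} \<union> (if b \<in> S then {} else {1}) \<union> (if a \<in> S then {} else {3})"

definition decoded_parts :: "nat \<Rightarrow> nat \<Rightarrow> nat \<Rightarrow> nat set" where
  "decoded_parts a b i = {0, 2} \<union> (if i = b then {} else {1}) \<union> (if i = a then {} else {3})"

text \<open>Parts 0 and 2 are on every link, part 1 on the links avoiding \<open>b\<close>, and part
  3 on those avoiding \<open>a\<close>.\<close>

lemma links_meeting_parts:
  "{S \<in> WW K i. link_parts a b S \<inter> F \<noteq> {}} =
    (if 0 \<in> F \<or> 2 \<in> F then WW K i
     else if 1 \<in> F then (if 3 \<in> F then WW K i - (WW K a \<inter> WW K b) else WW K i - WW K b)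
     else if 3 \<in> F then WW K i - WW K a else {})"
  by (auto simp: link_parts_def WW_def)

text \<open>The inequalities of the region give the rate conditions for all sets of parts, but not
  strictly. The factor \<open>\<theta> < 1\<close> makes them strict as soon as all parts in the set
  have positive rate.\<close>

lemma achievable_scaled:
  fixes r1 r2 \<theta> :: real
  assumes N: "\<forall>S\<in>PP K. N S \<ge> 1" and ab: "a \<in> {1..K}" "b \<in> {1..K}" "a \<noteq> b"
    and \<theta>: "0 \<le> \<theta>" "\<theta> < 1" and r: "0 \<le> r1" "0 \<le> r2"
    and r2: "r2 \<le> Csum N (WW K b)" and r1: "r1 \<le> Csum N (WW K a)"
    and common: "\<And>j. j \<in> {1..K} - {a, b} \<Longrightarrow> r1 + r2 \<le> Csum N (WW K j)"
    and union: "r1 + r2 \<le> Csum N (WW K a - WW K b) + Csum N (WW K b)"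
    and twice: "\<And>j. j \<in> {1..K} - {a, b} \<Longrightarrow>
        2 * (r1 + r2) \<le> Csum N (WW K j - (WW K a \<inter> WW K b)) + Csum N (WW K a) + Csum N (WW K b)"
  shows "achievable K N {cmpl K {b}, cmpl K {a}} (\<lambda>A. if A = cmpl K {b} then \<theta> * r1 else \<theta> * r2)"
proof -
  define Ca where "Ca = Csum N (WW K a)"
  define Cb where "Cb = Csum N (WW K b)"
  \<comment> \<open>The largest share of the first message that receiver \<open>b\<close> can decode
    on top of its own; \<open>p2\<close> is the same for receiver \<open>a\<close>. What is left has
    rate \<open>r1 - p1\<close>, the maximum of 0 and \<open>r1 + r2 - Cb\<close>.\<close>
  define p1 where "p1 = min r1 (Cb - r2)"
  define p2 where "p2 = min r2 (Ca - r1)"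
  define q where "q = (\<lambda>g::nat. if g = 0 then p1 else if g = 1 then r1 - p1 else
      if g = 2 then p2 else if g = 3 then r2 - p2 else 0)"
  have q0: "0 \<le> q g" for g
    using r r1 r2 by (auto simp: q_def p1_def p2_def Ca_def Cb_def)
  have split: "Csum N W = Csum N (W - W') + Csum N (W \<inter> W')" if "W \<subseteq> PP K" for W W'
    using that Csum_Un_disjoint[of "W - W'" K "W \<inter> W'" N] by (simp add: Un_Diff_Int) blast
  have diff_le: "Csum N (WW K i) \<le> Csum N (WW K i - WW K k) + Csum N (WW K k)" for i k
    using split[of "WW K i" "WW K k"] Csum_mono[OF N, of "WW K i \<inter> WW K k" "WW K k"]
    by (simp add: WW_subset_PP)
  \<comment> \<open>Both forms bound the sum rate by the capacity of the links seen by
    \<open>a\<close> or \<open>b\<close>.\<close>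
  have union': "r1 + r2 \<le> Csum N (WW K b - WW K a) + Ca"
    using union split[of "WW K a" "WW K b"] split[of "WW K b" "WW K a"]
    by (simp add: WW_subset_PP Int_commute Ca_def)
  have Cnn: "0 \<le> Csum N W" if "W \<subseteq> PP K" for W
    using Csum_mono[OF N, of "{}" W] that by (simp add: Csum_def)
  have diff_PP: "WW K i - WW K k \<subseteq> PP K" for i k using WW_subset_PP by blast
  have hall: "sum q F \<le> Csum N {S \<in> WW K i. link_parts a b S \<inter> F \<noteq> {}}"
    if i: "i \<in> {1..K}" and F: "F \<subseteq> decoded_parts a b i" for i F
  proof -
    have finD: "finite (decoded_parts a b i)" by (simp add: decoded_parts_def)
    have D4: "decoded_parts a b i \<subseteq> {0, 1, 2, 3}" by (auto simp: decoded_parts_def)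
    consider (P) "0 \<in> F \<or> 2 \<in> F" | (Q1) "F = {1}" | (Q2) "F = {3}" | (Q12) "F = {1, 3}" | (none) "F = {}"
      using F D4 by blast
    then show ?thesis
    proof cases
      case P
      \<comment> \<open>Such an \<open>F\<close> meets every link of \<open>i\<close>, so the worst
        case is that all decoded parts are wrong.\<close>
      have "sum q F \<le> sum q (decoded_parts a b i)"
        using finD F q0 by (intro sum_mono2) auto
      also have "\<dots> \<le> Csum N (WW K i)"
      proof -
        consider "i = a" | "i = b" | "i \<in> {1..K} - {a, b}" using i by blast
        then show ?thesis
        proof cases
          case 1
          then have "sum q (decoded_parts a b i) = r1 + p2"
            using ab by (simp add: decoded_parts_def q_def)
          then show ?thesis using 1 by (simp add: p2_def Ca_def)
        next
          case 2
          then have "sum q (decoded_parts a b i) = r2 + p1"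
            using ab by (simp add: decoded_parts_def q_def)
          then show ?thesis using 2 by (simp add: p1_def Cb_def)
        next
          case 3
          then have "sum q (decoded_parts a b i) = r1 + r2"
            by (simp add: decoded_parts_def q_def)
          then show ?thesis using common[OF 3] by simp
        qed
      qed
      finally show ?thesis unfolding links_meeting_parts using P by simp
    next
      case Q1
      then have ne: "i \<noteq> b" using F by (auto simp: decoded_parts_def split: if_splits)
      have "r1 + r2 - Cb \<le> Csum N (WW K i - WW K b)"
        using union common[of i] diff_le[of i b] i ne by (cases "i = a") (auto simp: Cb_def)
      then have "r1 - p1 \<le> Csum N (WW K i - WW K b)"
        using Cnn[OF diff_PP, of i b] by (auto simp: p1_def min_def)
      then show ?thesis unfolding links_meeting_parts using Q1 by (simp add: q_def)
    next
      case Q2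
      then have ne: "i \<noteq> a" using F by (auto simp: decoded_parts_def split: if_splits)
      have "r1 + r2 - Ca \<le> Csum N (WW K i - WW K a)"
        using union' common[of i] diff_le[of i a] i ne by (cases "i = b") (auto simp: Ca_def)
      then have "r2 - p2 \<le> Csum N (WW K i - WW K a)"
        using Cnn[OF diff_PP, of i a] by (auto simp: p2_def min_def)
      then show ?thesis unfolding links_meeting_parts using Q2 by (simp add: q_def)
    next
      case Q12
      then have j: "i \<in> {1..K} - {a, b}" using F i by (auto simp: decoded_parts_def split: if_splits)
      define W where "W = WW K i - (WW K a \<inter> WW K b)"
      have W: "W \<subseteq> PP K" by (auto simp: W_def WW_def)
      have "Csum N (WW K i - WW K b) \<le> Csum N W" "Csum N (WW K i - WW K a) \<le> Csum N W"
        by (intro Csum_mono[OF N _ W]; auto simp: W_def)+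
      then have "r1 + r2 - Cb \<le> Csum N W" "r1 + r2 - Ca \<le> Csum N W"
        using diff_le[of i a] diff_le[of i b] common[OF j] by (auto simp: Ca_def Cb_def)
      moreover have "2 * (r1 + r2) - Ca - Cb \<le> Csum N W"
        using twice[OF j] by (simp add: Ca_def Cb_def W_def)
      \<comment> \<open>Resolving both minima leaves four values: 0, the two single excesses, and
        \<open>2 * (r1 + r2) - Ca - Cb\<close>. The last is where the inequality with the factor 2
        enters.\<close>
      ultimately have "(r1 - p1) + (r2 - p2) \<le> Csum N W"
        using Cnn[OF W] by (auto simp: p1_def p2_def min_def)
      then show ?thesis unfolding links_meeting_parts using Q12 by (simp add: q_def W_def)
    next
      case none
      then show ?thesis by (simp add: Csum_def)
    qed
  qed
  have cm: "cmpl K {b} \<noteq> cmpl K {a}" using ab(1,3) by (rule cmpl_single_neq)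
  have "achievable K N {cmpl K {b}, cmpl K {a}}
    (\<lambda>A. if A = cmpl K {b} then \<theta> * q 0 + \<theta> * q 1 else \<theta> * q 2 + \<theta> * q 3)"
  proof (rule achievable_by_splitting[where E = "link_parts a b" and D = "decoded_parts a b", OF N cm])
    fix i F assume i: "i \<in> cmpl K {b} \<union> cmpl K {a}" and F: "F \<subseteq> decoded_parts a b i" "F \<noteq> {}"
      and pos: "\<And>g. g \<in> F \<Longrightarrow> 0 < \<theta> * q g"
    have "finite F" using F(1) by (rule finite_subset) (simp add: decoded_parts_def)
    moreover have "\<theta> * q g < q g" if "g \<in> F" for g
      using pos[OF that] \<theta> q0[of g] by (simp add: zero_less_mult_iff)
    ultimately have "(\<Sum>g\<in>F. \<theta> * q g) < sum q F" using F(2) by (intro sum_strict_mono)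
    also have "\<dots> \<le> Csum N {S \<in> WW K i. link_parts a b S \<inter> F \<noteq> {}}"
      using i by (intro hall F(1)) (auto simp: cmpl_def)
    finally show "(\<Sum>g\<in>F. \<theta> * q g) < Csum N {S \<in> WW K i. link_parts a b S \<inter> F \<noteq> {}}" .
  next
    show "0 \<le> \<theta> * q g" for g using \<theta> q0 by simp
  qed (auto simp: cmpl_def link_parts_def decoded_parts_def WW_def)
  moreover have "\<theta> * q 0 + \<theta> * q 1 = \<theta> * r1" "\<theta> * q 2 + \<theta> * q 3 = \<theta> * r2"
    by (simp_all add: q_def algebra_simps)
  ultimately show ?thesis by (simp only:)
qed

theorem theorem4:
  fixes K :: nat and N :: "nat set \<Rightarrow> nat"
  assumes "K \<ge> 3"
    and "\<forall>S\<in>PP K. N S \<ge> 1"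
  shows "capacity_region2 K N (cmpl K {K}) (cmpl K {K - 1}) =
    {(r1, r2). 0 \<le> r1 \<and> 0 \<le> r2 \<and>
       r2 \<le> Csum N (WW K K) \<and>
       r1 \<le> Csum N (WW K (K - 1)) \<and>
       (\<forall>j\<in>{1..K-2}. r2 + r1 \<le> Csum N (WW K j)) \<and>
       r2 + r1 \<le> Csum N (down (WW K (K - 1)) {cmpl K {K}}) + Csum N (WW K K) \<and>
       (\<forall>j\<in>{1..K-2}. 2 * r2 + 2 * r1 \<le>
          Csum N (down (WW K j) {cmpl K {K - 1}, cmpl K {K}})
          + Csum N (WW K K) + Csum N (WW K (K - 1)))}"
    (is "_ = ?region")
proof -
  define a b where "a = K - 1" and "b = K"
  define J where "J = {1..K} - {a, b}"
  define A1 A2 where "A1 = cmpl K {b}" and "A2 = cmpl K {a}"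
  define L where "L = {(r1, r2). achievable K N {A1, A2} (\<lambda>A. if A = A1 then r1 else r2)}"
  note N = assms(2)
  have ab: "a \<in> {1..K}" "b \<in> {1..K}" "a \<noteq> b" using assms(1) by (auto simp: a_def b_def)
  have J: "{1..K-2} = J" using assms(1) by (auto simp: J_def a_def b_def)
  have ne: "A1 \<noteq> A2" unfolding A1_def A2_def using ab(1,3) by (rule cmpl_single_neq)
  have region: "?region = {(r1, r2). 0 \<le> r1 \<and> 0 \<le> r2 \<and>
       r2 \<le> Csum N (WW K b) \<and> r1 \<le> Csum N (WW K a) \<and>
       (\<forall>j\<in>J. r2 + r1 \<le> Csum N (WW K j)) \<and>
       r2 + r1 \<le> Csum N (WW K a - WW K b) + Csum N (WW K b) \<and>
       (\<forall>j\<in>J. 2 * r2 + 2 * r1 \<le>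
          Csum N (WW K j - (WW K b \<inter> WW K a)) + Csum N (WW K b) + Csum N (WW K a))}" (is "_ = ?R")
    using down_WW_single[OF ab(2), of a] down_WW_pair[OF ab(1,2)]
    unfolding J by (simp only: a_def b_def)
  have sub: "L \<subseteq> ?R"
  proof (clarify, unfold L_def, clarify)
    fix r1 r2 :: real
    define R where "R = (\<lambda>A. if A = A1 then r1 else r2)"
    assume "achievable K N {A1, A2} (\<lambda>A. if A = A1 then r1 else r2)"
    then have ach: "achievable K N {A1, A2} R" by (simp add: R_def)
    \<comment> \<open>Exchanging the messages turns the bound on the first rate into the bound on
      \<open>r2\<close>.\<close>
    then have ach': "achievable K N {A2, A1} R" by (simp add: insert_commute)
    have R: "R A1 = r1" "R A2 = r2" using ne by (auto simp: R_def)
    have mem: "a \<in> A1" "b \<in> A2" "\<And>j. j \<in> J \<Longrightarrow> j \<in> A1" "\<And>j. j \<in> J \<Longrightarrow> j \<in> A2"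
      using ab by (auto simp: A1_def A2_def J_def cmpl_def)
    note bounds = achievable_bounds[OF N ne ach, unfolded R]
    have "0 \<le> r1" "0 \<le> r2" using ach R by (auto simp: achievable_def)
    moreover have "r2 \<le> Csum N (WW K b)"
      using achievable_bounds(1)[OF N ne[symmetric] ach' mem(2)] by (simp add: R)
    \<comment> \<open>The pair bound with both receivers equal to \<open>j\<close>.\<close>
    moreover have "r2 + r1 \<le> Csum N (WW K j)" if "j \<in> J" for j
      using bounds(2)[OF mem(3,4)[OF that]] by simp
    moreover have "r2 + r1 \<le> Csum N (WW K a - WW K b) + Csum N (WW K b)"
    proof -
      have "Csum N ((WW K a - WW K b) \<union> WW K b) = Csum N (WW K a - WW K b) + Csum N (WW K b)"
        by (rule Csum_Un_disjoint[where K = K]) (auto simp: WW_def)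
      then show ?thesis using bounds(2)[OF mem(1,2)] by simp
    qed
    moreover have "2 * r2 + 2 * r1 \<le>
        Csum N (WW K j - (WW K b \<inter> WW K a)) + Csum N (WW K b) + Csum N (WW K a)" if "j \<in> J" for j
      using bounds(3)[OF mem(1,2) mem(3,4)[OF that]] by (simp add: Int_commute)
    ultimately show "0 \<le> r1 \<and> 0 \<le> r2 \<and>
       r2 \<le> Csum N (WW K b) \<and> r1 \<le> Csum N (WW K a) \<and>
       (\<forall>j\<in>J. r2 + r1 \<le> Csum N (WW K j)) \<and>
       r2 + r1 \<le> Csum N (WW K a - WW K b) + Csum N (WW K b) \<and>
       (\<forall>j\<in>J. 2 * r2 + 2 * r1 \<le>
          Csum N (WW K j - (WW K b \<inter> WW K a)) + Csum N (WW K b) + Csum N (WW K a))"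
      using bounds(1)[OF mem(1)] by blast
  qed
  have "closed ?R"
    unfolding case_prod_beta Ball_def
    by (intro closed_Collect_conj closed_Collect_all closed_Collect_imp open_Collect_const
        closed_Collect_le continuous_intros)
  with sub have "closure L \<subseteq> ?R" by (rule closure_minimal)
  moreover have "?R \<subseteq> closure L"
  proof clarify
    fix r1 r2 :: real
    assume r: "0 \<le> r1" "0 \<le> r2" "r2 \<le> Csum N (WW K b)" "r1 \<le> Csum N (WW K a)"
      and common: "\<forall>j\<in>J. r2 + r1 \<le> Csum N (WW K j)"
      and union: "r2 + r1 \<le> Csum N (WW K a - WW K b) + Csum N (WW K b)"
      and twice: "\<forall>j\<in>J. 2 * r2 + 2 * r1 \<le>
          Csum N (WW K j - (WW K b \<inter> WW K a)) + Csum N (WW K b) + Csum N (WW K a)"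
    \<comment> \<open>Scaled points are achievable and converge to the given one, so boundary points
      are reached through the closure in the definition of the capacity region.\<close>
    define \<theta> where "\<theta> = (\<lambda>k. 1 - inverse (real (Suc k)))"
    have "(\<theta> k * r1, \<theta> k * r2) \<in> L" for k
    proof -
      have th: "0 \<le> \<theta> k" "\<theta> k < 1" by (simp_all add: \<theta>_def field_simps)
      have "achievable K N {cmpl K {b}, cmpl K {a}} (\<lambda>A. if A = cmpl K {b} then \<theta> k * r1 else \<theta> k * r2)"
        by (rule achievable_scaled[OF N ab th r])
          (use common union twice in \<open>auto simp: J_def add_ac Int_commute\<close>)
      then show ?thesis by (simp add: L_def A1_def A2_def)
    qed
    moreover have "\<theta> \<longlonglongrightarrow> 1"
      using tendsto_diff[OF tendsto_const[of 1] LIMSEQ_inverse_real_of_nat] by (simp add: \<theta>_def)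
    then have "(\<lambda>k. (\<theta> k * r1, \<theta> k * r2)) \<longlonglongrightarrow> (1 * r1, 1 * r2)"
      by (intro tendsto_Pair tendsto_mult tendsto_const)
    ultimately show "(r1, r2) \<in> closure L"
      unfolding closure_sequential by (intro exI[of _ "\<lambda>k. (\<theta> k * r1, \<theta> k * r2)"]) auto
  qed
  ultimately show ?thesis
    unfolding region capacity_region2_def by (simp add: L_def A1_def A2_def a_def b_def)
qed

end
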